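(* Consider the binary voting model and the Wisdom-of-the-Crowd-Voting mechanism defined in the context, and let $c=\frac13\min\{T_{\ell h}-P_{\ell H},\;T_{\ell\ell}-T_{\ell h},\;P_{\ell L}-T_{\ell\ell},\;P_{hH}-T_{hh},\;T_{hh}-T_{h\ell},\;T_{h\ell}-P_{hL}\}$. If all the agents play the truthful strategy, then, with probability at least $1-2\exp(-2c^2\alpha_C T)$, the mechanism outputs an alternative that is favored by more than half of the agents.
   Context: Model. There are $T$ agents ($T$ odd), two alternatives $\mathbf A$ (accept) and $\mathbf R$ (reject), and two worlds $L,H$. The actual world $W$ is random with $\Pr(W=L)=P_L>0$, $\Pr(W=H)=P_H>0$, $P_L+P_H=1$. Given $W$, the agents receive conditionally i.i.d. private signals $S_t\in\{\ell,h\}$ with $P_{mn}=\Pr(S_t=m\mid W=n)$, where $P_{\ell L}>P_{\ell H}$ and $P_{hH}>P_{hL}$. All these parameters are common knowledge. Posterior prediction. For $m,m'\in\{\ell,h\}$, $T_{m'm}=\frac{P_LP_{mL}}{P_LP_{mL}+P_HP_{mH}}P_{m'L}+\frac{P_HP_{mH}}{P_LP_{mL}+P_HP_{mH}}P_{m'H}$, the probability an agent with signal $m$ assigns to another agent receiving signal $m'$. Utilities. Agent $t$ has a utility function $v_t:\{L,H\}\times\{\mathbf A,\mathbf R\}\to\{0,1,\dots,B\}$ ($B$ a positive integer) with $v_t(H,\mathbf A)>v_t(L,\mathbf A)$, $v_t(H,\mathbf R)<v_t(L,\mathbf R)$, $v_t(L,\mathbf A)\ne v_t(L,\mathbf R)$,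 $v_t(H,\mathbf A)\neq v_t(H,\mathbf R)$. An agent favors the alternative with larger $v_t(n,\cdot)$, where $n$ is the actual world. Each agent has one of three types: $F$ (candidate-friendly) if $\mathbf A$ is favored in both worlds; $U$ (candidate-unfriendly) if $\mathbf R$ is favored in both worlds; $C$ (contingent) if $\mathbf R$ is favored in $L$ and $\mathbf A$ is favored in $H$. The fractions of agents of types $F,U,C$ are $\alpha_F,\alpha_U,\alpha_C$; they are common knowledge. Mechanism. Each agent reports a type in $\{F,U,C\}$; an agent reporting $C$ also reports a signal $\bar s_t\in\{\ell,h\}$ and a prediction $\bar\delta_t$ of the fraction of agents whose (treated) reported signal is $h$. For an agent reporting $F$ the mechanism sets $\bar s_t=h$, $\bar\delta_t=0$; for an agent reporting $U$ it sets $\bar s_t=\ell$, $\bar\delta_t=1$. Let $\bar\delta$ be the median of all $\bar\delta_t$. If more than half of the agents report $F$, output $\mathbf A$; if more than half report $U$, output $\mathbf R$; otherwise output $\mathbf A$ if the fraction of agents with $\bar s_t=h$ is more than $\bar\delta$, and $\mathbf R$ otherwise. Truthful strategy. Each agent reports the true type; a type $C$ agent with signal $m$ reports $\bar s_t=m$ and the prediction given by its posterior belief, $\bar\delta_t=\alpha_F+\alpha_CT_{hm}$. *)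

theory Defs
  imports "HOL-Probability.Probability"
begin

datatype world = World_L | World_H

datatype signal = Sig_l | Sig_h

datatype alternative = Accept | Reject

type_synonym utility = "world \<Rightarrow> alternative \<Rightarrow> nat"

definition admissible_utility :: "nat \<Rightarrow> utility \<Rightarrow> bool" where
  "admissible_utility B v \<longleftrightarrow>
     (\<forall>n a. v n a \<le> B) \<and>
     v World_H Accept > v World_L Accept \<and>
     v World_H Reject < v World_L Reject \<and>
     v World_L Accept \<noteq> v World_L Reject \<and>
     v World_H Accept \<noteq> v World_H Reject"

definition favors :: "utility \<Rightarrow> world \<Rightarrow> alternative \<Rightarrow> bool" where
  "favors v n a \<longleftrightarrow> (\<forall>b. b \<noteq> a \<longrightarrow> v n b < v n a)"

datatype agent_type = Friendly | Unfriendly | Contingent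

definition type_of :: "utility \<Rightarrow> agent_type" where
  "type_of v =
     (if favors v World_L Accept \<and> favors v World_H Accept then Friendly
      else if favors v World_L Reject \<and> favors v World_H Reject then Unfriendly
      else Contingent)"

text \<open>
  The final \<open>else\<close> branch is the contingent type: an admissible utility cannot favor
  Accept in \<open>L\<close> and Reject in \<open>H\<close>.
\<close>

lemma type_of_iff:
  assumes "admissible_utility B v"
  shows "type_of v = Friendly \<longleftrightarrow> favors v World_L Accept \<and> favors v World_H Accept"
    and "type_of v = Unfriendly \<longleftrightarrow> favors v World_L Reject \<and> favors v World_H Reject"
    and "type_of v = Contingent \<longleftrightarrow> favors v World_L Reject \<and> favors v World_H Accept"
proof -
  have *: "favors w n Accept \<longleftrightarrow> w n Reject < w n Accept"
    "favors w n Reject \<longleftrightarrow> w n Accept < w n Reject" for w n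
    unfolding favors_def by (metis alternative.exhaust alternative.distinct(1))+
  show "type_of v = Friendly \<longleftrightarrow> favors v World_L Accept \<and> favors v World_H Accept"
    and "type_of v = Unfriendly \<longleftrightarrow> favors v World_L Reject \<and> favors v World_H Reject"
    and "type_of v = Contingent \<longleftrightarrow> favors v World_L Reject \<and> favors v World_H Accept"
    using assms unfolding type_of_def admissible_utility_def * by auto
qed

text \<open>
  The agents are \<open>0, \<dots>, T - 1\<close>. The parameters are the prior \<open>prior n = Pr(W = n)\<close> and the
  signal probabilities \<open>P m n = Pr(S\<^sub>t = m | W = n)\<close>. Signals are conditionally i.i.d.:
  independent under the measure conditioned on each world, with a conditional law that does
  not depend on the agent.
\<close>

locale binary_voting_model = prob_space M
  for M :: "'a measure" +
  fixes T :: nat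
    and W :: "'a \<Rightarrow> world"
    and S :: "nat \<Rightarrow> 'a \<Rightarrow> signal"
    and prior :: "world \<Rightarrow> real"
    and P :: "signal \<Rightarrow> world \<Rightarrow> real"
    and B :: nat
    and v :: "nat \<Rightarrow> utility"
  assumes T_odd: "odd T"
    and W_measurable: "W \<in> measurable M (count_space UNIV)"
    and S_measurable: "\<And>t. t < T \<Longrightarrow> S t \<in> measurable M (count_space UNIV)"
    and prior: "\<And>n. \<P>(\<omega> in M. W \<omega> = n) = prior n"
    and prior_pos: "\<And>n. prior n > 0"
    and signal_law: "\<And>t m n. t < T \<Longrightarrow> \<P>(\<omega> in M. S t \<omega> = m \<bar> W \<omega> = n) = P m n"
    and signals_cond_indep: "\<And>n. prob_space.indep_vars
          (uniform_measure M {\<omega> \<in> space M. W \<omega> = n}) (\<lambda>_. count_space UNIV) S {..<T}"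
    and signal_l: "P Sig_l World_L > P Sig_l World_H"
    and signal_h: "P Sig_h World_H > P Sig_h World_L"
    and B_pos: "B > 0"
    and utilities: "\<And>t. t < T \<Longrightarrow> admissible_utility B (v t)"

definition type_fraction :: "nat \<Rightarrow> (nat \<Rightarrow> utility) \<Rightarrow> agent_type \<Rightarrow> real" where
  "type_fraction T v \<tau> = real (card {t. t < T \<and> type_of (v t) = \<tau>}) / real T"

text \<open>
  \<open>posterior_prediction prior P m' m\<close> is the probability that an agent with signal \<open>m\<close>
  assigns to another agent receiving signal \<open>m'\<close>, written \<open>T\<close> with subscript \<open>m' m\<close>
  in that order.
\<close>

definition posterior_prediction ::
    "(world \<Rightarrow> real) \<Rightarrow> (signal \<Rightarrow> world \<Rightarrow> real) \<Rightarrow> signal \<Rightarrow> signal \<Rightarrow> real" where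
  "posterior_prediction prior P m' m =
     (prior World_L * P m World_L) / (prior World_L * P m World_L + prior World_H * P m World_H)
       * P m' World_L
   + (prior World_H * P m World_H) / (prior World_L * P m World_L + prior World_H * P m World_H)
       * P m' World_H"

datatype report = Report_F | Report_U | Report_C signal real

fun treated_signal :: "report \<Rightarrow> signal" where
  "treated_signal Report_F = Sig_h"
| "treated_signal Report_U = Sig_l"
| "treated_signal (Report_C s d) = s"

fun treated_prediction :: "report \<Rightarrow> real" where
  "treated_prediction Report_F = 0"
| "treated_prediction Report_U = 1"
| "treated_prediction (Report_C s d) = d"

text \<open>Only used for odd \<open>T\<close>, where the middle entry of the sorted list is the median.\<close>

definition median :: "nat \<Rightarrow> (nat \<Rightarrow> real) \<Rightarrow> real" where
  "median T d = sort (map d [0..<T]) ! (T div 2)"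

definition wisdom_of_the_crowd_voting :: "nat \<Rightarrow> (nat \<Rightarrow> report) \<Rightarrow> alternative" where
  "wisdom_of_the_crowd_voting T r =
     (if real (card {t. t < T \<and> r t = Report_F}) > real T / 2 then Accept
      else if real (card {t. t < T \<and> r t = Report_U}) > real T / 2 then Reject
      else if real (card {t. t < T \<and> treated_signal (r t) = Sig_h}) / real T
                > median T (\<lambda>t. treated_prediction (r t)) then Accept
      else Reject)"

definition truthful_report ::
    "nat \<Rightarrow> (world \<Rightarrow> real) \<Rightarrow> (signal \<Rightarrow> world \<Rightarrow> real) \<Rightarrow> (nat \<Rightarrow> utility)
      \<Rightarrow> nat \<Rightarrow> signal \<Rightarrow> report" where
  "truthful_report T prior P v t m =
     (case type_of (v t) of
        Friendly \<Rightarrow> Report_F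
      | Unfriendly \<Rightarrow> Report_U
      | Contingent \<Rightarrow> Report_C m
          (type_fraction T v Friendly
            + type_fraction T v Contingent * posterior_prediction prior P Sig_h m))"

definition majority_favors :: "nat \<Rightarrow> (nat \<Rightarrow> utility) \<Rightarrow> world \<Rightarrow> alternative \<Rightarrow> bool" where
  "majority_favors T v n a \<longleftrightarrow> real (card {t. t < T \<and> favors (v t) n a}) > real T / 2"

end

theory Submission
  imports Defs
begin

text \<open>
  If the friendly or the unfriendly agents form a majority, the outcome is always right. Otherwise
  the predictions of the friendly agents (0) and of the unfriendly agents (1) each occupy less than
  half of the sorted list of predictions, so the median lies between the two predictions
  \<open>\<alpha>\<^sub>F + \<alpha>\<^sub>C T\<^sub>h\<^sub>\<ell>\<close> and \<open>\<alpha>\<^sub>F + \<alpha>\<^sub>C T\<^sub>h\<^sub>h\<close> of contingent agents. A wrong outcome then forces the fraction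
  of \<open>h\<close>-signals among the contingent agents to cross from its mean \<open>P\<^sub>h\<^sub>H\<close> below \<open>T\<^sub>h\<^sub>h\<close>
  (in world \<open>H\<close>), or from its mean \<open>P\<^sub>h\<^sub>L\<close> above \<open>T\<^sub>h\<^sub>\<ell>\<close> (in world \<open>L\<close>). Both deviations
  are at least \<open>3c\<close>, and Hoeffding's inequality applies conditionally on each world.
\<close>

section \<open>Order statistics and the median\<close>

text \<open>Sorting permutes the entries and commutes with \<open>filter\<close>, so counting
  positions of the sorted list is the same as counting agents.\<close>

lemma card_sort_nth:
  fixes d :: "nat \<Rightarrow> real"
  shows "card {i. i < T \<and> Q (sort (map d [0..<T]) ! i)} = card {t. t < T \<and> Q (d t)}"
proof -
  have "card {i. i < T \<and> Q (sort (map d [0..<T]) ! i)} = length (filter Q (sort (map d [0..<T])))"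
    by (simp add: length_filter_conv_card)
  also have "\<dots> = length (filter Q (map d [0..<T]))"
    by (simp add: filter_sort)
  also have "\<dots> = card {t. t < T \<and> Q (d t)}"
    by (simp add: length_filter_conv_card cong: conj_cong)
  finally show ?thesis .
qed

text \<open>If the middle entry were below \<open>x\<close>, so would be all
  \<open>T div 2 + 1\<close> entries up to it, which is more than half of them.\<close>

lemma median_ge:
  assumes "2 * card {t. t < T \<and> d t < x} < T"
  shows "x \<le> median T d"
proof (rule ccontr)
  let ?s = "sort (map d [0..<T])"
  assume "\<not> x \<le> median T d"
  then have lt: "?s ! (T div 2) < x"
    by (simp add: median_def)
  have "{..T div 2} \<subseteq> {i. i < T \<and> ?s ! i < x}"
  proof
    fix i assume "i \<in> {..T div 2}"
    moreover have "T div 2 < T"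
      using assms by simp
    ultimately have "i < T" "?s ! i \<le> ?s ! (T div 2)"
      by (auto intro!: sorted_nth_mono)
    with lt show "i \<in> {i. i < T \<and> ?s ! i < x}"
      by simp
  qed
  then have "card {..T div 2} \<le> card {i. i < T \<and> ?s ! i < x}"
    by (intro card_mono) auto
  also have "\<dots> = card {t. t < T \<and> d t < x}"
    by (rule card_sort_nth)
  finally show False
    using assms by simp
qed

text \<open>The mirror image: the positions from the middle one upwards number
  \<open>T - T div 2\<close>, at least half of all.\<close>

lemma median_le:
  assumes "2 * card {t. t < T \<and> x < d t} < T"
  shows "median T d \<le> x"
proof (rule ccontr)
  let ?s = "sort (map d [0..<T])"
  assume "\<not> median T d \<le> x"
  then have gt: "x < ?s ! (T div 2)"
    by (simp add: median_def)
  have "{T div 2..<T} \<subseteq> {i. i < T \<and> x < ?s ! i}"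
  proof
    fix i assume "i \<in> {T div 2..<T}"
    then have "i < T" "?s ! (T div 2) \<le> ?s ! i"
      by (auto intro!: sorted_nth_mono)
    with gt show "i \<in> {i. i < T \<and> x < ?s ! i}"
      by simp
  qed
  then have "card {T div 2..<T} \<le> card {i. i < T \<and> x < ?s ! i}"
    by (intro card_mono) auto
  also have "\<dots> = card {t. t < T \<and> x < d t}"
    by (rule card_sort_nth)
  finally show False
    using assms by simp
qed

text \<open>Makes the outcome a function of the finitely many signals of actual agents, which its
  measurability rests on.\<close>

lemma wisdom_of_the_crowd_voting_cong:
  assumes "\<And>t. t < T \<Longrightarrow> r t = r' t"
  shows "wisdom_of_the_crowd_voting T r = wisdom_of_the_crowd_voting T r'"
proof -
  have "map (\<lambda>t. treated_prediction (r t)) [0..<T] = map (\<lambda>t. treated_prediction (r' t)) [0..<T]"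
    using assms by simp
  then have "median T (\<lambda>t. treated_prediction (r t)) = median T (\<lambda>t. treated_prediction (r' t))"
    unfolding median_def by (simp only:)
  then show ?thesis
    unfolding wisdom_of_the_crowd_voting_def by (simp add: assms cong: conj_cong)
qed

lemma UNIV_signal: "(UNIV :: signal set) = {Sig_l, Sig_h}"
  by (auto intro: signal.exhaust)

section \<open>Type counts and conditional signal laws\<close>

context binary_voting_model
begin

definition agents_of_type :: "agent_type \<Rightarrow> nat set" where
  "agents_of_type \<tau> = {t. t < T \<and> type_of (v t) = \<tau>}"

abbreviation "nC \<equiv> real (card (agents_of_type Contingent))"

abbreviation "post \<equiv> posterior_prediction prior P"

text \<open>Taking a signal profile instead of a sample point keeps the analysis of wrong outcomes
  deterministic; probability enters only when \<open>S\<close> is substituted.\<close>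

definition outcome :: "(nat \<Rightarrow> signal) \<Rightarrow> alternative" where
  "outcome s = wisdom_of_the_crowd_voting T (\<lambda>t. truthful_report T prior P v t (s t))"

lemma T_pos: "T > 0"
  using T_odd by (cases T) auto

lemma finite_agents_of_type [simp]: "finite (agents_of_type \<tau>)"
  by (simp add: agents_of_type_def)

lemma type_fraction_eq: "type_fraction T v \<tau> = real (card (agents_of_type \<tau>)) / real T"
  by (simp add: type_fraction_def agents_of_type_def)

lemma card_agents:
  "card (agents_of_type Friendly) + card (agents_of_type Unfriendly)
     + card (agents_of_type Contingent) = T"
proof -
  have "{..<T} = agents_of_type Friendly \<union> agents_of_type Unfriendly \<union> agents_of_type Contingent"
    by (auto simp: agents_of_type_def intro: agent_type.exhaust)
  then have "T = card (agents_of_type Friendly \<union> agents_of_type Unfriendly \<union> agents_of_type Contingent)"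
    by (metis card_lessThan)
  also have "\<dots> = card (agents_of_type Friendly) + card (agents_of_type Unfriendly)
     + card (agents_of_type Contingent)"
    by (subst card_Un_disjoint; auto simp: agents_of_type_def card_Un_disjoint)+
  finally show ?thesis by simp
qed

lemma W_event [measurable]: "{\<omega> \<in> space M. W \<omega> = n} \<in> events"
  using measurable_sets[OF W_measurable, of "{n}"]
  by (simp add: vimage_def Int_def conj_commute)

lemma S_event: "t < T \<Longrightarrow> {\<omega> \<in> space M. S t \<omega> = m} \<in> events"
  using measurable_sets[OF S_measurable, of t "{m}"]
  by (simp add: vimage_def Int_def conj_commute)

lemma cond_prob_space: "prob_space (uniform_measure M {\<omega> \<in> space M. W \<omega> = n})"
  using prior[of n] prior_pos[of n] by (intro prob_space_uniform_measure) (auto simp: emeasure_eq_measure)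

lemma prob_cond:
  assumes "A \<in> events"
  shows "prob ({\<omega> \<in> space M. W \<omega> = n} \<inter> A)
    = prior n * measure (uniform_measure M {\<omega> \<in> space M. W \<omega> = n}) A"
  using prior[of n] prior_pos[of n] assms
  by (subst measure_uniform_measure) (auto simp: emeasure_eq_measure)

lemma prior_sum: "prior World_L + prior World_H = 1"
proof -
  have "prob {\<omega> \<in> space M. W \<omega> = World_L} + prob {\<omega> \<in> space M. W \<omega> = World_H}
      = prob ({\<omega> \<in> space M. W \<omega> = World_L} \<union> {\<omega> \<in> space M. W \<omega> = World_H})"
    by (subst finite_measure_Union) auto
  also have "{\<omega> \<in> space M. W \<omega> = World_L} \<union> {\<omega> \<in> space M. W \<omega> = World_H} = space M"
    by (auto intro: world.exhaust)
  finally show ?thesis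
    by (simp add: prior prob_space)
qed

text \<open>Links the conditional probability in \<open>signal_law\<close> to the conditioned
  measure in which independence is stated.\<close>

lemma cond_signal_prob:
  assumes "t < T"
  shows "measure (uniform_measure M {\<omega> \<in> space M. W \<omega> = n}) {\<omega> \<in> space M. S t \<omega> = m} = P m n"
proof -
  have "measure (uniform_measure M {\<omega> \<in> space M. W \<omega> = n}) {\<omega> \<in> space M. S t \<omega> = m}
     = \<P>(\<omega> in M. S t \<omega> = m \<bar> W \<omega> = n)"
    using W_event S_event[OF assms]
    by (subst measure_uniform_measure_eq_cond_prob[symmetric]) (auto simp: pred_def)
  with signal_law[OF assms] show ?thesis by simp
qed

text \<open>The bounds on \<open>P\<close> are recovered from the law of an actual signal, that of
  agent 0, who exists because \<open>T\<close> is odd.\<close>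

lemma P_nonneg: "P m n \<ge> 0"
  using cond_signal_prob[OF T_pos, of n m] by (metis measure_nonneg)

lemma P_sum: "P Sig_l n + P Sig_h n = 1"
proof -
  let ?N = "uniform_measure M {\<omega> \<in> space M. W \<omega> = n}"
  interpret N: prob_space ?N by (rule cond_prob_space)
  have "N.prob {\<omega> \<in> space M. S 0 \<omega> = Sig_l} + N.prob {\<omega> \<in> space M. S 0 \<omega> = Sig_h}
      = N.prob ({\<omega> \<in> space M. S 0 \<omega> = Sig_l} \<union> {\<omega> \<in> space M. S 0 \<omega> = Sig_h})"
    using S_event[OF T_pos] by (subst N.finite_measure_Union) auto
  also have "{\<omega> \<in> space M. S 0 \<omega> = Sig_l} \<union> {\<omega> \<in> space M. S 0 \<omega> = Sig_h} = space ?N"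
    by (auto intro: signal.exhaust)
  finally show ?thesis
    using N.prob_space by (simp add: cond_signal_prob T_pos)
qed

section \<open>Position of the posterior predictions among the signal probabilities\<close>

text \<open>By Bayes' rule, the posterior probability of world \<open>L\<close> after signal
  \<open>m\<close>.\<close>

definition weight_L :: "signal \<Rightarrow> real" where
  "weight_L m = prior World_L * P m World_L / (prior World_L * P m World_L + prior World_H * P m World_H)"

text \<open>Each signal has positive probability in the world that makes it likelier, since the
  strictly smaller probability is nonnegative.\<close>

lemma denominator_pos: "prior World_L * P m World_L + prior World_H * P m World_H > 0"
proof (cases m)
  case Sig_l
  then have "P m World_L > 0"
    using signal_l P_nonneg[of Sig_l World_H] by simp
  then show ?thesis
    using prior_pos P_nonneg by (intro add_pos_nonneg mult_pos_pos mult_nonneg_nonneg) (auto simp: less_imp_le)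
next
  case Sig_h
  then have "P m World_H > 0"
    using signal_h P_nonneg[of Sig_h World_L] by simp
  then show ?thesis
    using prior_pos P_nonneg by (intro add_nonneg_pos mult_pos_pos mult_nonneg_nonneg) (auto simp: less_imp_le)
qed

text \<open>The two posterior weights sum to 1, so the prediction is affine in
  \<open>weight_L m\<close> alone.\<close>

lemma post_eq: "post m' m = P m' World_H + weight_L m * (P m' World_L - P m' World_H)"
proof -
  have *: "prior World_H * P m World_H / (prior World_L * P m World_L + prior World_H * P m World_H)
      = 1 - weight_L m"
    using denominator_pos[of m] by (simp add: weight_L_def field_simps)
  show ?thesis
    unfolding posterior_prediction_def * unfolding weight_L_def[symmetric]
    by (simp add: algebra_simps)
qed

lemma weight_L_bounds: "weight_L m \<in> {0..1}"
  using denominator_pos[of m] P_nonneg prior_pos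
  by (auto simp: weight_L_def field_simps less_imp_le intro!: divide_nonneg_pos)

lemma P_l_eq: "P Sig_l n = 1 - P Sig_h n"
  using P_sum[of n] by simp

text \<open>After cross-multiplication and \<open>P_l_eq\<close> the common products cancel, leaving
  \<open>signal_h\<close> scaled by both priors.\<close>

lemma weight_L_mono: "weight_L Sig_h \<le> weight_L Sig_l"
proof -
  let ?D = "\<lambda>m. prior World_L * P m World_L + prior World_H * P m World_H"
  have "prior World_L * prior World_H * P Sig_h World_L \<le> prior World_L * prior World_H * P Sig_h World_H"
    using signal_h prior_pos by (intro mult_left_mono) (auto simp: less_imp_le)
  then have "prior World_L * P Sig_h World_L * ?D Sig_l \<le> prior World_L * P Sig_l World_L * ?D Sig_h"
    by (simp add: P_l_eq algebra_simps)
  then show ?thesis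
    unfolding weight_L_def using denominator_pos by (simp add: divide_le_eq pos_le_divide_eq)
qed

text \<open>By \<open>post_eq\<close> the prediction of \<open>h\<close> decreases in the weight of
  \<open>L\<close>. Comparing the two weights with each other, and with 1 and 0, places both
  predictions in order between the two signal probabilities.\<close>

lemma post_h_mono: "post Sig_h Sig_l \<le> post Sig_h Sig_h"
  using mult_right_mono[OF weight_L_mono, of "P Sig_h World_H - P Sig_h World_L"] signal_h
  by (simp add: post_eq algebra_simps)

lemma post_h_lower: "P Sig_h World_L \<le> post Sig_h Sig_l"
  using mult_right_mono[of "weight_L Sig_l" 1 "P Sig_h World_H - P Sig_h World_L"]
    weight_L_bounds[of Sig_l] signal_h
  by (simp add: post_eq algebra_simps)

lemma post_h_upper: "post Sig_h Sig_h \<le> P Sig_h World_H"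
  using mult_right_mono[of 0 "weight_L Sig_h" "P Sig_h World_H - P Sig_h World_L"]
    weight_L_bounds[of Sig_h] signal_h
  by (simp add: post_eq algebra_simps)

lemma post_l_eq: "post Sig_l m = 1 - post Sig_h m"
  by (simp add: post_eq P_l_eq algebra_simps)

section \<open>Alternatives favored by a majority\<close>

text \<open>Contingent agents side with the friendly ones in \<open>H\<close> and with the
  unfriendly ones in \<open>L\<close>, so in each world a single type dissents.\<close>

lemma favors_of_type:
  assumes "t < T"
  shows "favors (v t) World_H Accept \<longleftrightarrow> type_of (v t) \<noteq> Unfriendly"
    and "favors (v t) World_L Reject \<longleftrightarrow> type_of (v t) \<noteq> Friendly"
    and "type_of (v t) = Friendly \<Longrightarrow> favors (v t) n Accept"
    and "type_of (v t) = Unfriendly \<Longrightarrow> favors (v t) n Reject"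
proof -
  have excl: "\<not> (favors w k Accept \<and> favors w k Reject)" for w k
    unfolding favors_def by (metis alternative.distinct(1) less_asym)
  note iff = type_of_iff[OF utilities[OF assms]]
  show "favors (v t) World_H Accept \<longleftrightarrow> type_of (v t) \<noteq> Unfriendly"
    "favors (v t) World_L Reject \<longleftrightarrow> type_of (v t) \<noteq> Friendly"
    using iff excl[of "v t"] by (cases "type_of (v t)"; auto)+
  show "type_of (v t) = Friendly \<Longrightarrow> favors (v t) n Accept"
    "type_of (v t) = Unfriendly \<Longrightarrow> favors (v t) n Reject"
    using iff by (cases n; auto)+
qed

lemma card_not_type:
  "card {t. t < T \<and> type_of (v t) \<noteq> \<tau>} + card (agents_of_type \<tau>) = T"
proof -
  have "card {t. t < T \<and> type_of (v t) \<noteq> \<tau>} + card (agents_of_type \<tau>)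
      = card ({t. t < T \<and> type_of (v t) \<noteq> \<tau>} \<union> agents_of_type \<tau>)"
    by (rule card_Un_disjoint[symmetric]) (auto simp: agents_of_type_def)
  also have "{t. t < T \<and> type_of (v t) \<noteq> \<tau>} \<union> agents_of_type \<tau> = {..<T}"
    by (auto simp: agents_of_type_def)
  finally show ?thesis by simp
qed

lemma majority_favors_H_Accept:
  assumes "2 * card (agents_of_type Unfriendly) < T"
  shows "majority_favors T v World_H Accept"
proof -
  have "{t. t < T \<and> favors (v t) World_H Accept} = {t. t < T \<and> type_of (v t) \<noteq> Unfriendly}"
    using favors_of_type(1) by auto
  then show ?thesis
    using card_not_type[of Unfriendly] assms unfolding majority_favors_def by simp
qed

lemma majority_favors_L_Reject:
  assumes "2 * card (agents_of_type Friendly) < T"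
  shows "majority_favors T v World_L Reject"
proof -
  have "{t. t < T \<and> favors (v t) World_L Reject} = {t. t < T \<and> type_of (v t) \<noteq> Friendly}"
    using favors_of_type(2) by auto
  then show ?thesis
    using card_not_type[of Friendly] assms unfolding majority_favors_def by simp
qed

lemma majority_favors_Accept:
  assumes "2 * card (agents_of_type Friendly) > T"
  shows "majority_favors T v n Accept"
proof -
  have "card (agents_of_type Friendly) \<le> card {t. t < T \<and> favors (v t) n Accept}"
    using favors_of_type(3) by (intro card_mono) (auto simp: agents_of_type_def)
  then show ?thesis
    using assms unfolding majority_favors_def by linarith
qed

lemma majority_favors_Reject:
  assumes "2 * card (agents_of_type Unfriendly) > T"
  shows "majority_favors T v n Reject"
proof -
  have "card (agents_of_type Unfriendly) \<le> card {t. t < T \<and> favors (v t) n Reject}"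
    using favors_of_type(4) by (intro card_mono) (auto simp: agents_of_type_def)
  then show ?thesis
    using assms unfolding majority_favors_def by linarith
qed

section \<open>Outcome and median under truthful reports\<close>

lemma truthful_report_simps:
  "type_of (v t) = Friendly \<Longrightarrow> truthful_report T prior P v t m = Report_F"
  "type_of (v t) = Unfriendly \<Longrightarrow> truthful_report T prior P v t m = Report_U"
  "type_of (v t) = Contingent \<Longrightarrow> truthful_report T prior P v t m
    = Report_C m (type_fraction T v Friendly + type_fraction T v Contingent * post Sig_h m)"
  by (simp_all add: truthful_report_def)

lemma truthful_report_iff:
  "truthful_report T prior P v t m = Report_F \<longleftrightarrow> type_of (v t) = Friendly"
  "truthful_report T prior P v t m = Report_U \<longleftrightarrow> type_of (v t) = Unfriendly"
  "treated_signal (truthful_report T prior P v t m) = Sig_h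
     \<longleftrightarrow> type_of (v t) = Friendly \<or> type_of (v t) = Contingent \<and> m = Sig_h"
  by (cases "type_of (v t)"; simp add: truthful_report_def)+

definition h_count :: "(nat \<Rightarrow> signal) \<Rightarrow> nat" where
  "h_count s = card {t \<in> agents_of_type Contingent. s t = Sig_h}"

abbreviation truthful_median :: "(nat \<Rightarrow> signal) \<Rightarrow> real" where
  "truthful_median s \<equiv> median T (\<lambda>t. treated_prediction (truthful_report T prior P v t (s t)))"

lemma outcome_eq:
  "outcome s =
     (if 2 * card (agents_of_type Friendly) > T then Accept
      else if 2 * card (agents_of_type Unfriendly) > T then Reject
      else if real (card (agents_of_type Friendly) + h_count s) / real T > truthful_median s
        then Accept
      else Reject)"
proof -
  have "{t. t < T \<and> (type_of (v t) = Friendly \<or> type_of (v t) = Contingent \<and> s t = Sig_h)}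
      = agents_of_type Friendly \<union> {t \<in> agents_of_type Contingent. s t = Sig_h}"
    by (auto simp: agents_of_type_def)
  also have "card \<dots> = card (agents_of_type Friendly) + h_count s"
    unfolding h_count_def by (rule card_Un_disjoint) (simp, simp, auto simp: agents_of_type_def)
  finally have count: "card {t. t < T \<and> (type_of (v t) = Friendly \<or> type_of (v t) = Contingent \<and> s t = Sig_h)}
      = card (agents_of_type Friendly) + h_count s" .
  \<comment> \<open>Majority thresholds move to the naturals, where the parity of \<open>T\<close>
    can later exclude ties.\<close>
  have half: "real k > real T / 2 \<longleftrightarrow> 2 * k > T" for k
    by linarith
  show ?thesis
    unfolding outcome_def wisdom_of_the_crowd_voting_def truthful_report_iff half count
    by (simp only: agents_of_type_def)
qed

text \<open>Ensures that contingent predictions stay between the extreme reports 0 and 1.\<close>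

lemma post_h_in_unit_interval: "post Sig_h m \<in> {0..1}"
proof -
  have "P Sig_h World_L \<le> post Sig_h m" "post Sig_h m \<le> P Sig_h World_H"
    using post_h_mono post_h_lower post_h_upper by (cases m; simp)+
  moreover have "0 \<le> P Sig_h World_L" "P Sig_h World_H \<le> 1"
    using P_nonneg[of Sig_h World_L] P_nonneg[of Sig_l World_H] P_l_eq[of World_H] by auto
  ultimately show ?thesis by simp
qed

lemma truthful_median_bounds:
  assumes F: "2 * card (agents_of_type Friendly) < T"
    and U: "2 * card (agents_of_type Unfriendly) < T"
  shows "(real (card (agents_of_type Friendly)) + nC * post Sig_h Sig_l) / T \<le> truthful_median s"
    and "truthful_median s \<le> (real (card (agents_of_type Friendly)) + nC * post Sig_h Sig_h) / T"
proof -
  let ?nF = "real (card (agents_of_type Friendly))"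
  let ?p = "\<lambda>t. treated_prediction (truthful_report T prior P v t (s t))"
  \<comment> \<open>The prediction of a contingent agent with signal \<open>m\<close>, over the
    common denominator \<open>T\<close>.\<close>
  let ?q = "\<lambda>m. (?nF + nC * post Sig_h m) / T"
  have q_mono: "?q Sig_l \<le> ?q m" "?q m \<le> ?q Sig_h" for m
    using post_h_mono by (cases m; auto intro!: divide_right_mono mult_left_mono)+
  have q_range: "0 \<le> ?q m" "?q m \<le> 1" for m
  proof -
    have "0 \<le> nC * post Sig_h m" "nC * post Sig_h m \<le> nC * 1"
      using post_h_in_unit_interval[of m] by (auto intro!: mult_left_mono simp del: mult_1_right)
    moreover have "?nF + nC \<le> T"
      using card_agents by linarith
    ultimately show "0 \<le> ?q m" "?q m \<le> 1"
      using T_pos by auto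
  qed
  have p_C: "?p t = ?q (s t)" if "type_of (v t) = Contingent" for t
    using that by (simp add: truthful_report_simps type_fraction_eq add_divide_distrib)
  \<comment> \<open>Unfriendly agents predict 1 and contingent ones at least
    \<open>?q Sig_l\<close>, so only a minority can lie strictly below this value.\<close>
  have "t \<in> agents_of_type Friendly" if "t < T" "?p t < ?q Sig_l" for t
  proof (cases "type_of (v t)")
    case Unfriendly
    then show ?thesis
      using that q_range(2)[of Sig_l] by (simp add: truthful_report_simps)
  next
    case Contingent
    then show ?thesis
      using that q_mono(1)[of "s t"] p_C by simp
  qed (use that in \<open>simp add: agents_of_type_def\<close>)
  then have "card {t. t < T \<and> ?p t < ?q Sig_l} \<le> card (agents_of_type Friendly)"
    by (intro card_mono) auto
  with F show "?q Sig_l \<le> truthful_median s"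
    by (intro median_ge) linarith
  have "t \<in> agents_of_type Unfriendly" if "t < T" "?q Sig_h < ?p t" for t
  proof (cases "type_of (v t)")
    case Friendly
    then show ?thesis
      using that q_range(1)[of Sig_h] by (simp add: truthful_report_simps)
  next
    case Contingent
    then show ?thesis
      using that q_mono(2)[of "s t"] p_C by simp
  qed (use that in \<open>simp add: agents_of_type_def\<close>)
  then have "card {t. t < T \<and> ?q Sig_h < ?p t} \<le> card (agents_of_type Unfriendly)"
    by (intro card_mono) auto
  with U show "truthful_median s \<le> ?q Sig_h"
    by (intro median_le) linarith
qed

section \<open>Wrong outcomes as deviations of the signal count\<close>

text \<open>A majority of friendly or unfriendly agents triggers one of the first two branches,
  which is right in both worlds. Two strict minorities cannot exhaust the agents, so some agent is
  contingent.\<close>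

lemma no_majority:
  assumes "\<not> majority_favors T v n (outcome s)"
  shows "2 * card (agents_of_type Friendly) < T" "2 * card (agents_of_type Unfriendly) < T"
    "agents_of_type Contingent \<noteq> {}"
proof -
  have F: "\<not> 2 * card (agents_of_type Friendly) > T"
    using assms majority_favors_Accept by (auto simp: outcome_eq)
  moreover have U: "\<not> 2 * card (agents_of_type Unfriendly) > T"
    using assms majority_favors_Reject F by (auto simp: outcome_eq)
  \<comment> \<open>Oddness rules out a type with exactly half of the agents.\<close>
  moreover have "2 * k \<noteq> T" for k
    using T_odd by auto
  ultimately show *: "2 * card (agents_of_type Friendly) < T" "2 * card (agents_of_type Unfriendly) < T"
    by (meson linorder_neqE_nat)+
  show "agents_of_type Contingent \<noteq> {}"
    using * card_agents by auto
qed

text \<open>A majority favors \<open>Accept\<close> here, so the outcome is \<open>Reject\<close>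
  and the share of \<open>h\<close> is at most the median. Friendly agents contribute equally to the
  share and to the median bound, so their count cancels.\<close>

lemma wrong_outcome_H:
  assumes "\<not> majority_favors T v World_H (outcome s)"
  shows "real (h_count s) \<le> nC * post Sig_h Sig_h"
proof -
  note * = no_majority[OF assms]
  have "outcome s \<noteq> Accept"
    using assms majority_favors_H_Accept[OF *(2)] by auto
  then have "(real (card (agents_of_type Friendly)) + real (h_count s)) / T \<le> truthful_median s"
    using * by (auto simp: outcome_eq split: if_splits)
  also note truthful_median_bounds(2)[OF *(1,2), of s]
  finally show ?thesis
    using T_pos by (simp add: divide_le_cancel)
qed

lemma wrong_outcome_L:
  assumes "\<not> majority_favors T v World_L (outcome s)"
  shows "nC * post Sig_h Sig_l \<le> real (h_count s)"
proof -
  note * = no_majority[OF assms]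
  have "outcome s \<noteq> Reject"
    using assms majority_favors_L_Reject[OF *(1)] by auto
  then have "truthful_median s \<le> (real (card (agents_of_type Friendly)) + real (h_count s)) / T"
    using * by (auto simp: outcome_eq split: if_splits)
  with truthful_median_bounds(1)[OF *(1,2), of s]
  have "(real (card (agents_of_type Friendly)) + nC * post Sig_h Sig_l) / T
      \<le> (real (card (agents_of_type Friendly)) + real (h_count s)) / T"
    by (rule order_trans)
  then show ?thesis
    using T_pos by (simp add: divide_le_cancel)
qed

section \<open>Conditional probability of a wrong outcome\<close>

text \<open>Such an event is a finite union, over the admissible profiles of \<open>T\<close>
  signals, of finite intersections of signal events.\<close>

lemma signals_event:
  assumes "\<And>s s'. (\<And>t. t < T \<Longrightarrow> s t = s' t) \<Longrightarrow> Q s \<longleftrightarrow> Q s'"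
  shows "{\<omega> \<in> space M. Q (\<lambda>t. S t \<omega>)} \<in> events"
proof -
  \<comment> \<open>Extensional profiles fix the values outside \<open>{..<T}\<close>, which keeps
    the set finite.\<close>
  let ?A = "{s \<in> {..<T} \<rightarrow>\<^sub>E (UNIV :: signal set). Q s}"
  have "finite ({..<T} \<rightarrow>\<^sub>E (UNIV :: signal set))"
    by (intro finite_PiE) (simp_all add: UNIV_signal)
  then have finite: "finite ?A"
    by (rule rev_finite_subset) blast
  have "Q (\<lambda>t. S t \<omega>) \<longleftrightarrow> (\<exists>s\<in>?A. \<forall>t\<in>{..<T}. S t \<omega> = s t)" for \<omega>
  proof
    assume "Q (\<lambda>t. S t \<omega>)"
    then have "Q (restrict (\<lambda>t. S t \<omega>) {..<T})"
      using assms[of "\<lambda>t. S t \<omega>" "restrict (\<lambda>t. S t \<omega>) {..<T}"] by simp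
    then show "\<exists>s\<in>?A. \<forall>t\<in>{..<T}. S t \<omega> = s t"
      by (intro bexI[of _ "restrict (\<lambda>t. S t \<omega>) {..<T}"]) auto
  next
    assume "\<exists>s\<in>?A. \<forall>t\<in>{..<T}. S t \<omega> = s t"
    then show "Q (\<lambda>t. S t \<omega>)"
      using assms by (metis (no_types, lifting) lessThan_iff mem_Collect_eq)
  qed
  then have "{\<omega> \<in> space M. Q (\<lambda>t. S t \<omega>)} = {\<omega> \<in> space M. \<exists>s\<in>?A. \<forall>t\<in>{..<T}. S t \<omega> = s t}"
    by simp
  also have "\<dots> \<in> events"
    using finite by (intro sets.sets_Collect_finite_Ex sets.sets_Collect_finite_All S_event) simp_all
  finally show ?thesis .
qed

lemma wrong_outcome_event:
  "{\<omega> \<in> space M. \<not> majority_favors T v n (outcome (\<lambda>t. S t \<omega>))} \<in> events"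
proof (rule signals_event)
  fix s s' :: "nat \<Rightarrow> signal"
  assume "\<And>t. t < T \<Longrightarrow> s t = s' t"
  then have "outcome s = outcome s'"
    unfolding outcome_def by (intro wisdom_of_the_crowd_voting_cong) simp
  then show "\<not> majority_favors T v n (outcome s) \<longleftrightarrow> \<not> majority_favors T v n (outcome s')"
    by simp
qed

text \<open>Given the world, \<open>h_count\<close> is a sum of independent 0-1 variables with mean
  \<open>P Sig_h n\<close>, so Hoeffding's inequality applies with total deviation
  \<open>nC * \<epsilon>\<close>.\<close>

lemma h_count_tail_bounds:
  assumes "\<epsilon> \<ge> 0" and "agents_of_type Contingent \<noteq> {}"
  defines "N \<equiv> \<lambda>n. uniform_measure M {\<omega> \<in> space M. W \<omega> = n}"
  shows "measure (N n) {\<omega> \<in> space M. real (h_count (\<lambda>t. S t \<omega>)) \<ge> nC * P Sig_h n + nC * \<epsilon>}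
      \<le> exp (- 2 * \<epsilon>\<^sup>2 * nC)"
    and "measure (N n) {\<omega> \<in> space M. real (h_count (\<lambda>t. S t \<omega>)) \<le> nC * P Sig_h n - nC * \<epsilon>}
      \<le> exp (- 2 * \<epsilon>\<^sup>2 * nC)"
proof -
  let ?C = "agents_of_type Contingent"
  let ?X = "\<lambda>t \<omega>. if S t \<omega> = Sig_h then 1 else (0 :: real)"
  interpret N: prob_space "N n"
    unfolding N_def by (rule cond_prob_space)
  have sub: "?C \<subseteq> {..<T}"
    by (auto simp: agents_of_type_def)
  have signals_indep: "N.indep_vars (\<lambda>_. count_space UNIV) S {..<T}"
    unfolding N_def by (rule signals_cond_indep)
  have indep: "N.indep_vars (\<lambda>_. borel) ?X ?C"
    using N.indep_vars_compose2[OF N.indep_vars_subset[OF signals_indep sub],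
        of "\<lambda>_ s. if s = Sig_h then 1 else 0" "\<lambda>_. borel"]
    by simp
  interpret indep_interval_bounded_random_variables "N n" ?C ?X "\<lambda>_. 0" "\<lambda>_. 1"
    by unfold_locales (use indep in auto)
  have "N.expectation (?X t) = P Sig_h n" if "t \<in> ?C" for t
  proof -
    have t: "t < T"
      using that sub by auto
    have "N.expectation (?X t) = N.expectation (indicator {\<omega> \<in> space M. S t \<omega> = Sig_h})"
      by (intro Bochner_Integration.integral_cong) (auto simp: N_def)
    also have "\<dots> = P Sig_h n"
      using cond_signal_prob[OF t, of n Sig_h] S_event[OF t, of Sig_h]
      by (simp add: N_def Int_absorb1)
    finally show ?thesis .
  qed
  then have mu: "(\<Sum>t\<in>?C. N.expectation (?X t)) = nC * P Sig_h n"
    by simp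
  interpret Hoeffding_ineq "N n" ?C ?X "\<lambda>_. 0" "\<lambda>_. 1" "nC * P Sig_h n"
    by unfold_locales (simp add: mu)
  have sum: "(\<Sum>t\<in>?C. ?X t \<omega>) = real (h_count (\<lambda>t. S t \<omega>))" for \<omega>
    by (simp add: h_count_def sum.If_cases Int_def)
  have nC: "nC > 0"
    using assms(2) by (simp add: card_gt_0_iff)
  \<comment> \<open>The squared interval lengths sum to \<open>nC\<close>, cancelling one of its two
    factors.\<close>
  have exponent: "- 2 * (nC * \<epsilon>)\<^sup>2 / (\<Sum>t\<in>?C. (1 - 0)\<^sup>2) = - 2 * \<epsilon>\<^sup>2 * nC"
    using nC by (simp add: power2_eq_square field_simps)
  have pos: "(\<Sum>t\<in>?C. (1 - 0 :: real)\<^sup>2) > 0"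
    using nC by simp
  have nn: "nC * \<epsilon> \<ge> 0"
    using assms(1) by simp
  show "measure (N n) {\<omega> \<in> space M. real (h_count (\<lambda>t. S t \<omega>)) \<ge> nC * P Sig_h n + nC * \<epsilon>}
      \<le> exp (- 2 * \<epsilon>\<^sup>2 * nC)"
    using Hoeffding_ineq_ge[OF nn pos] unfolding sum exponent by (simp add: N_def)
  show "measure (N n) {\<omega> \<in> space M. real (h_count (\<lambda>t. S t \<omega>)) \<le> nC * P Sig_h n - nC * \<epsilon>}
      \<le> exp (- 2 * \<epsilon>\<^sup>2 * nC)"
    using Hoeffding_ineq_le[OF nn pos] unfolding sum exponent by (simp add: N_def)
qed

text \<open>A wrong outcome is a lower-tail event in \<open>H\<close> and an upper-tail event in
  \<open>L\<close>, each at distance at least \<open>c\<close> per contingent agent from the mean.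
  Without contingent agents it is impossible.\<close>

lemma wrong_outcome_cond_prob:
  assumes c: "c \<ge> 0" "c \<le> P Sig_h World_H - post Sig_h Sig_h" "c \<le> post Sig_h Sig_l - P Sig_h World_L"
  shows "measure (uniform_measure M {\<omega> \<in> space M. W \<omega> = n})
      {\<omega> \<in> space M. \<not> majority_favors T v n (outcome (\<lambda>t. S t \<omega>))} \<le> exp (- 2 * c\<^sup>2 * nC)"
    (is "measure ?N ?E \<le> _")
proof (cases "agents_of_type Contingent = {}")
  case True
  then have "?E = {}"
    using no_majority(3) by blast
  then show ?thesis
    by (simp only: measure_empty exp_ge_zero)
next
  case False
  interpret N: prob_space ?N
    by (rule cond_prob_space)
  have h_count_event: "{\<omega> \<in> space M. R (h_count (\<lambda>t. S t \<omega>))} \<in> events" for R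
  proof (rule signals_event)
    fix s s' :: "nat \<Rightarrow> signal"
    assume "\<And>t. t < T \<Longrightarrow> s t = s' t"
    then have "h_count s = h_count s'"
      unfolding h_count_def agents_of_type_def by (intro arg_cong[where f = card]) auto
    then show "R (h_count s) \<longleftrightarrow> R (h_count s')"
      by simp
  qed
  show ?thesis
  proof (cases n)
    case World_H
    have "nC * post Sig_h Sig_h \<le> nC * P Sig_h World_H - nC * c"
      using mult_left_mono[OF c(2), of nC] by (simp add: algebra_simps)
    then have "?E \<subseteq> {\<omega> \<in> space M. real (h_count (\<lambda>t. S t \<omega>)) \<le> nC * P Sig_h n - nC * c}"
      using wrong_outcome_H World_H by fastforce
    then show ?thesis
      using h_count_event
      by (intro order_trans[OF N.finite_measure_mono h_count_tail_bounds(2)[OF c(1) False]]) auto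
  next
    case World_L
    have "nC * P Sig_h World_L + nC * c \<le> nC * post Sig_h Sig_l"
      using mult_left_mono[OF c(3), of nC] by (simp add: algebra_simps)
    then have "?E \<subseteq> {\<omega> \<in> space M. real (h_count (\<lambda>t. S t \<omega>)) \<ge> nC * P Sig_h n + nC * c}"
      using wrong_outcome_L World_L by fastforce
    then show ?thesis
      using h_count_event
      by (intro order_trans[OF N.finite_measure_mono h_count_tail_bounds(1)[OF c(1) False]]) auto
  qed
qed

text \<open>By total probability, the bounds in the two worlds are averaged with prior weights
  summing to 1.\<close>

lemma right_outcome_prob:
  assumes c: "c \<ge> 0" "c \<le> P Sig_h World_H - post Sig_h Sig_h" "c \<le> post Sig_h Sig_l - P Sig_h World_L"
  shows "\<P>(\<omega> in M. majority_favors T v (W \<omega>) (outcome (\<lambda>t. S t \<omega>))) \<ge> 1 - exp (- 2 * c\<^sup>2 * nC)"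
proof -
  let ?E = "\<lambda>n. {\<omega> \<in> space M. \<not> majority_favors T v n (outcome (\<lambda>t. S t \<omega>))}"
  let ?W = "\<lambda>n. {\<omega> \<in> space M. W \<omega> = n}"
  \<comment> \<open>Splitting by world replaces the random \<open>W \<omega>\<close> by a constant
    on each piece, so \<open>prob_cond\<close> applies.\<close>
  let ?bad = "?W World_L \<inter> ?E World_L \<union> ?W World_H \<inter> ?E World_H"
  have bad: "?bad \<in> events"
    by (intro sets.Un sets.Int W_event wrong_outcome_event)
  have "prob ?bad \<le> prob (?W World_L \<inter> ?E World_L) + prob (?W World_H \<inter> ?E World_H)"
    by (intro measure_Un_le sets.Int W_event wrong_outcome_event)
  also have "\<dots> \<le> prior World_L * exp (- 2 * c\<^sup>2 * nC) + prior World_H * exp (- 2 * c\<^sup>2 * nC)"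
    unfolding prob_cond[OF wrong_outcome_event]
    by (intro add_mono mult_left_mono wrong_outcome_cond_prob c less_imp_le[OF prior_pos])
  also have "\<dots> = exp (- 2 * c\<^sup>2 * nC)"
    using prior_sum by (simp flip: distrib_right)
  finally have "1 - exp (- 2 * c\<^sup>2 * nC) \<le> prob (space M - ?bad)"
    using prob_compl[OF bad] by simp
  also have "space M - ?bad = {\<omega> \<in> space M. majority_favors T v (W \<omega>) (outcome (\<lambda>t. S t \<omega>))}"
  proof (intro set_eqI)
    fix \<omega>
    show "\<omega> \<in> space M - ?bad \<longleftrightarrow>
        \<omega> \<in> {\<omega> \<in> space M. majority_favors T v (W \<omega>) (outcome (\<lambda>t. S t \<omega>))}"
      by (cases "W \<omega>") auto
  qed
  finally show ?thesis .
qed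

end

theorem theorem3p2:
  fixes M :: "'a measure"
    and T :: nat
    and W :: "'a \<Rightarrow> world"
    and S :: "nat \<Rightarrow> 'a \<Rightarrow> signal"
    and prior :: "world \<Rightarrow> real"
    and P :: "signal \<Rightarrow> world \<Rightarrow> real"
    and B :: nat
    and v :: "nat \<Rightarrow> utility"
    and c :: real
  assumes "binary_voting_model M T W S prior P B v"
    and "c = 1 / 3 * Min
      {posterior_prediction prior P Sig_l Sig_h - P Sig_l World_H,
       posterior_prediction prior P Sig_l Sig_l - posterior_prediction prior P Sig_l Sig_h,
       P Sig_l World_L - posterior_prediction prior P Sig_l Sig_l,
       P Sig_h World_H - posterior_prediction prior P Sig_h Sig_h,
       posterior_prediction prior P Sig_h Sig_h - posterior_prediction prior P Sig_h Sig_l,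
       posterior_prediction prior P Sig_h Sig_l - P Sig_h World_L}"
  shows "\<P>(\<omega> in M. majority_favors T v (W \<omega>)
            (wisdom_of_the_crowd_voting T (\<lambda>t. truthful_report T prior P v t (S t \<omega>))))
         \<ge> 1 - 2 * exp (- 2 * c\<^sup>2 * type_fraction T v Contingent * real T)"
proof -
  interpret binary_voting_model M T W S prior P B v
    by (fact assms(1))
  let ?c1 = "P Sig_h World_H - post Sig_h Sig_h"
  let ?c2 = "post Sig_h Sig_h - post Sig_h Sig_l"
  let ?c3 = "post Sig_h Sig_l - P Sig_h World_L"
  \<comment> \<open>Passing to complementary signals turns each difference for \<open>l\<close> into
    one for \<open>h\<close>, so the six differences are three, each listed twice.\<close>
  have c: "c = 1 / 3 * Min {?c1, ?c2, ?c3}"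
  proof -
    have "{post Sig_l Sig_h - P Sig_l World_H, post Sig_l Sig_l - post Sig_l Sig_h,
        P Sig_l World_L - post Sig_l Sig_l, ?c1, ?c2, ?c3} = {?c1, ?c2, ?c3}"
      by (simp add: post_l_eq P_l_eq insert_commute)
    with assms(2) show ?thesis by (simp only:)
  qed
  have "0 \<le> ?c1" "0 \<le> ?c2" "0 \<le> ?c3"
    using post_h_mono post_h_lower post_h_upper by auto
  \<comment> \<open>A third of a minimum of nonnegative numbers is at most each of them.\<close>
  then have "c \<ge> 0" "c \<le> ?c1" "c \<le> ?c3"
    unfolding c by (auto simp: min_def)
  from right_outcome_prob[OF this]
  have "1 - exp (- 2 * c\<^sup>2 * nC) \<le> \<P>(\<omega> in M. majority_favors T v (W \<omega>)
      (wisdom_of_the_crowd_voting T (\<lambda>t. truthful_report T prior P v t (S t \<omega>))))"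
    by (simp only: outcome_def)
  moreover have "type_fraction T v Contingent * real T = nC"
    using T_pos by (simp add: type_fraction_eq)
  \<comment> \<open>Passes from one exponential to the two in the claim.\<close>
  moreover have "exp (- 2 * c\<^sup>2 * nC) \<ge> 0"
    by simp
  ultimately show ?thesis
    by (simp only: mult.assoc)
qed

end
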